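(* Let $G$ be a graph on the vertex set $[n]=\{1,2,\ldots,n\}$ and let $k$ be a non-negative integer. Let $S(G,k)$ be the number of set partitions of $[n]$ into $k$ blocks such that adjacent vertices of $G$ are in different blocks. Then $$S(G,k)=\frac{1}{k!}\cdot\Delta^{k}\bigl(\chi(G;x)\bigr)\Big|_{x=0},$$ where $\chi(G;x)$ is the chromatic polynomial of $G$.
   Context: Graphs are finite and simple. The blocks of a set partition are non-empty. The forward difference operator $\Delta$ on polynomials is $\Delta(p(x))=p(x+1)-p(x)$, and $\Delta^k$ is its $k$-fold iterate. The chromatic polynomial $\chi(G;x)$ is the polynomial whose value at each non-negative integer $x$ is the number of functions $f:[n]\to\{1,\ldots,x\}$ with $f(i)\ne f(j)$ for every edge $ij$ of $G$. *)

theory Defs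
  imports
    Complex_Main
    "HOL-Library.FuncSet"
    "HOL-Library.Disjoint_Sets"
    "HOL-Computational_Algebra.Polynomial"
begin

text \<open>A simple graph on the vertex set \<open>{1..n}\<close> is given by its set of edges, which are
  unordered pairs of distinct vertices.\<close>

definition simple_graph :: "nat \<Rightarrow> nat set set \<Rightarrow> bool" where
  "simple_graph n E \<longleftrightarrow> (\<forall>e\<in>E. \<exists>i\<in>{1..n}. \<exists>j\<in>{1..n}. i \<noteq> j \<and> e = {i, j})"

text \<open>Colourings are extensional functions (undefined outside \<open>{1..n}\<close>), so that each
  function \<open>{1..n} \<rightarrow> {1..x}\<close> is counted exactly once.\<close>

definition proper_colourings :: "nat \<Rightarrow> nat set set \<Rightarrow> nat \<Rightarrow> (nat \<Rightarrow> nat) set" where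
  "proper_colourings n E x =
     {f \<in> {1..n} \<rightarrow>\<^sub>E {1..x}. \<forall>i j. {i, j} \<in> E \<longrightarrow> f i \<noteq> f j}"

definition chromatic_poly :: "nat \<Rightarrow> nat set set \<Rightarrow> real poly" where
  "chromatic_poly n E =
     (THE p. \<forall>x::nat. poly p (of_nat x) = of_nat (card (proper_colourings n E x)))"

definition forward_diff :: "'a::comm_ring_1 poly \<Rightarrow> 'a poly" where
  "forward_diff p = pcompose p [:1, 1:] - p"

lemma poly_forward_diff: "poly (forward_diff p) x = poly p (x + 1) - poly p x"
  by (simp add: forward_diff_def poly_pcompose add.commute)

text \<open>Non-emptiness of the blocks is part of \<^const>\<open>partition_on\<close>.\<close>

definition stable_partitions :: "nat \<Rightarrow> nat set set \<Rightarrow> nat \<Rightarrow> nat set set set" where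
  "stable_partitions n E k =
     {P. partition_on {1..n} P \<and> card P = k \<and>
         (\<forall>i j. {i, j} \<in> E \<longrightarrow> (\<forall>B\<in>P. \<not> (i \<in> B \<and> j \<in> B)))}"

definition graph_stirling :: "nat \<Rightarrow> nat set set \<Rightarrow> nat \<Rightarrow> nat" where
  "graph_stirling n E k = card (stable_partitions n E k)"

end

theory Submission
  imports Defs
begin

text \<open>The classes of equally coloured vertices of a proper colouring form a stable partition \<open>P\<close>,
  and the colourings inducing \<open>P\<close> correspond to the injections from \<open>P\<close> into the colours.
  Hence \<open>\<chi>(G; x)\<close> is the sum of \<open>S(G, m) x(x - 1)\<dots>(x - m + 1)\<close> over \<open>m\<close>. The falling
  factorials behave under \<open>\<Delta>\<close> like the monomials under differentiation, so
  \<open>\<Delta>\<^sup>k\<close> at \<open>0\<close> extracts \<open>k! S(G, k)\<close>.\<close>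

section \<open>Falling factorials under the forward difference\<close>

definition ffact_poly :: "nat \<Rightarrow> real poly" where
  "ffact_poly m = (\<Prod>i<m. [:- of_nat i, 1:])"

lemma poly_ffact_poly: "poly (ffact_poly m) x = (\<Prod>i<m. x - of_nat i)"
  by (simp add: ffact_poly_def poly_prod)

text \<open>Truncated subtraction does no harm: for \<open>m \<le> x\<close> nothing is truncated,
  and otherwise the factor at \<open>i = x\<close> makes both products vanish. This links counts in
  the naturals to polynomial values.\<close>

lemma poly_ffact_poly_of_nat: "poly (ffact_poly m) (of_nat x) = of_nat (\<Prod>i<m. x - i)"
proof (cases "m \<le> x")
  case True
  then show ?thesis by (simp add: poly_ffact_poly of_nat_diff)
next
  case False
  then have "(\<Prod>i<m. x - i) = 0" "(\<Prod>i<m. real x - real i) = 0"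
    by (auto intro!: bexI[of _ x])
  then show ?thesis by (simp add: poly_ffact_poly del: prod_zero_iff)
qed

lemma poly_ffact_poly_0: "poly (ffact_poly m) 0 = (if m = 0 then 1 else 0)"
  by (auto simp: poly_ffact_poly)

text \<open>For positive \<open>m\<close>, the values at \<open>x + 1\<close> and \<open>x\<close>
  share the factor \<open>ffact_poly (m - 1)\<close>; their cofactors \<open>x + 1\<close> and
  \<open>x - (m - 1)\<close> differ by \<open>m\<close>. At \<open>m = 0\<close> the coefficient 0
  hides the truncated \<open>m - 1\<close>.\<close>

lemma forward_diff_ffact_poly:
  "forward_diff (ffact_poly m) = smult (of_nat m) (ffact_poly (m - 1))"
proof (cases m)
  case 0
  then show ?thesis by (simp add: forward_diff_def ffact_poly_def pcompose_1)
next
  case (Suc l)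
  have "poly (forward_diff (ffact_poly (Suc l))) x = poly (smult (1 + of_nat l) (ffact_poly l)) x"
    for x
  proof -
    have "poly (ffact_poly (Suc l)) (x + 1) = (x + 1) * poly (ffact_poly l) x"
      by (simp add: poly_ffact_poly prod.lessThan_Suc_shift del: prod.lessThan_Suc)
    moreover have "poly (ffact_poly (Suc l)) x = poly (ffact_poly l) x * (x - of_nat l)"
      by (simp add: poly_ffact_poly)
    ultimately show ?thesis
      by (simp add: poly_forward_diff algebra_simps)
  qed
  then show ?thesis
    using Suc by (auto intro: poly_ext)
qed

lemma forward_diff_add: "forward_diff (p + q) = forward_diff p + forward_diff q"
  by (simp add: forward_diff_def pcompose_add)

lemma forward_diff_smult: "forward_diff (smult c p) = smult c (forward_diff p)"
  by (simp add: forward_diff_def pcompose_smult smult_diff_right)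

lemma forward_diff_0: "forward_diff 0 = 0"
  by (simp add: forward_diff_def)

lemma funpow_forward_diff_smult:
  "(forward_diff ^^ k) (smult c p) = smult c ((forward_diff ^^ k) p)"
  by (induction k) (simp_all add: forward_diff_smult)

lemma funpow_forward_diff_add:
  "(forward_diff ^^ k) (p + q) = (forward_diff ^^ k) p + (forward_diff ^^ k) q"
  by (induction k) (simp_all add: forward_diff_add)

lemma funpow_forward_diff_sum:
  "(forward_diff ^^ k) (\<Sum>i\<in>A. f i) = (\<Sum>i\<in>A. (forward_diff ^^ k) (f i))"
proof (induction A rule: infinite_finite_induct)
  case (insert a A)
  then show ?case by (simp add: funpow_forward_diff_add)
qed (induction k; simp add: forward_diff_0)+

text \<open>Each difference pulls out the current index and lowers it by one. For
  \<open>m < k\<close> the factor 0 is reached; for \<open>m > k\<close> a falling factorial of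
  positive degree remains, which vanishes at 0.\<close>

lemma poly_funpow_forward_diff_ffact_poly_0:
  "poly ((forward_diff ^^ k) (ffact_poly m)) 0 = (if m = k then fact k else 0)"
proof (induction k arbitrary: m)
  case 0
  then show ?case by (simp add: poly_ffact_poly_0)
next
  case (Suc k)
  have "poly ((forward_diff ^^ Suc k) (ffact_poly m)) 0
      = of_nat m * poly ((forward_diff ^^ k) (ffact_poly (m - 1))) 0"
    by (simp add: funpow_Suc_right forward_diff_ffact_poly funpow_forward_diff_smult
        del: funpow.simps)
  then show ?case
    using Suc[of "m - 1"] by (cases m) auto
qed

section \<open>Colourings with prescribed colour classes\<close>

definition kernel_partition :: "'a set \<Rightarrow> ('a \<Rightarrow> 'b) \<Rightarrow> 'a set set" where
  "kernel_partition V f = (\<lambda>v. {w \<in> V. f w = f v}) ` V"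

lemma partition_on_kernel_partition: "partition_on V (kernel_partition V f)"
  unfolding kernel_partition_def by (rule partition_onI) (auto simp: disjnt_def)

lemma the_block_eq:
  assumes "partition_on V P" "B \<in> P" "v \<in> B"
  shows "(THE C. C \<in> P \<and> v \<in> C) = B"
proof (rule the_equality)
  show "C = B" if "C \<in> P \<and> v \<in> C" for C
    using that assms(2,3) partition_onD2[OF assms(1)] disjointD by fast
qed (use assms in auto)

text \<open>A colouring with classes \<open>P\<close> amounts to a choice of distinct colours for
  the blocks. Injectivity of \<open>g\<close> ensures that no two blocks merge into one
  class.\<close>

lemma bij_betw_inj_on_kernel_partition:
  assumes "partition_on V P"
  shows "bij_betw (\<lambda>g. \<lambda>v\<in>V. g (THE B. B \<in> P \<and> v \<in> B))
    {g \<in> P \<rightarrow>\<^sub>E T. inj_on g P} {f \<in> V \<rightarrow>\<^sub>E T. kernel_partition V f = P}"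
proof -
  define cls where "cls v = (THE B. B \<in> P \<and> v \<in> B)" for v
  have sub: "B \<subseteq> V" "B \<noteq> {}" if "B \<in> P" for B
    using that assms by (auto simp: partition_on_def)
  have cls_eq: "cls v = B" if "B \<in> P" "v \<in> B" for v B
    unfolding cls_def using assms that by (rule the_block_eq)
  have cls: "cls v \<in> P" "v \<in> cls v" if v: "v \<in> V" for v
  proof -
    obtain B where "B \<in> P" "v \<in> B"
      using v partition_onD1[OF assms] by blast
    then show "cls v \<in> P" "v \<in> cls v"
      by (simp_all add: cls_eq)
  qed
  have P: "P = cls ` V"
  proof (intro equalityI subsetI)
    fix B assume B: "B \<in> P"
    then obtain v where "v \<in> B"
      using sub(2) by blast
    with B show "B \<in> cls ` V"
      using cls_eq sub(1) by blast
  qed (auto simp: cls(1))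
  \<comment> \<open>\<open>P\<close> is thus the kernel partition of \<open>cls\<close> itself, and
    composing with an injective \<open>g\<close> leaves the kernel unchanged.\<close>
  have cls_set: "cls v = {w \<in> V. cls w = cls v}" if "v \<in> V" for v
  proof (intro equalityI subsetI)
    fix w assume "w \<in> cls v"
    then show "w \<in> {w \<in> V. cls w = cls v}"
      using cls_eq[OF cls(1)[OF that]] sub(1)[OF cls(1)[OF that]] by blast
  next
    fix w assume "w \<in> {w \<in> V. cls w = cls v}"
    then show "w \<in> cls v"
      using cls(2)[of w] by simp
  qed
  have "bij_betw (\<lambda>g. \<lambda>v\<in>V. g (cls v))
    {g \<in> P \<rightarrow>\<^sub>E T. inj_on g P} {f \<in> V \<rightarrow>\<^sub>E T. kernel_partition V f = P}"
    unfolding bij_betw_def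
  proof (intro conjI inj_onI equalityI subsetI)
    fix g h
    assume gh: "g \<in> {g \<in> P \<rightarrow>\<^sub>E T. inj_on g P}" "h \<in> {g \<in> P \<rightarrow>\<^sub>E T. inj_on g P}"
      and eq: "(\<lambda>v\<in>V. g (cls v)) = (\<lambda>v\<in>V. h (cls v))"
    have "g (cls v) = h (cls v)" if "v \<in> V" for v
      using fun_cong[OF eq, of v] that by simp
    then show "g = h"
      using gh by (intro PiE_ext[of g P "\<lambda>_. T" h]) (auto simp: P)
  next
    fix f
    assume "f \<in> (\<lambda>g. \<lambda>v\<in>V. g (cls v)) ` {g \<in> P \<rightarrow>\<^sub>E T. inj_on g P}"
    then obtain g where g: "g \<in> P \<rightarrow>\<^sub>E T" "inj_on g P" and f: "f = (\<lambda>v\<in>V. g (cls v))"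
      by auto
    have "{w \<in> V. f w = f v} = cls v" if "v \<in> V" for v
      using that cls_set[OF that] inj_on_eq_iff[OF g(2) cls(1) cls(1)] by (auto simp: f)
    then have "kernel_partition V f = P"
      by (simp add: kernel_partition_def P)
    moreover have "f \<in> V \<rightarrow>\<^sub>E T"
      using g(1) cls by (auto simp: f)
    ultimately show "f \<in> {f \<in> V \<rightarrow>\<^sub>E T. kernel_partition V f = P}"
      by simp
  next
    fix f
    assume "f \<in> {f \<in> V \<rightarrow>\<^sub>E T. kernel_partition V f = P}"
    then have f: "f \<in> V \<rightarrow>\<^sub>E T" and ker: "kernel_partition V f = P"
      by auto
    have cls_f: "cls v = {w \<in> V. f w = f v}" if "v \<in> V" for v
      using that by (intro cls_eq) (auto simp: ker[symmetric] kernel_partition_def)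
    \<comment> \<open>The inverse map: \<open>f\<close> is constant on each block, so the image of
      the block is a singleton holding its colour.\<close>
    define g where "g = (\<lambda>B\<in>P. the_elem (f ` B))"
    have g: "g (cls v) = f v" if "v \<in> V" for v
    proof -
      have "f ` cls v = {f v}"
        using that by (auto simp: cls_f)
      then show ?thesis
        using that cls by (simp add: g_def)
    qed
    have "f = (\<lambda>v\<in>V. g (cls v))"
    proof
      show "f v = (\<lambda>v\<in>V. g (cls v)) v" for v
        using g PiE_arb[OF f] by (cases "v \<in> V") simp_all
    qed
    moreover have "g \<in> P \<rightarrow>\<^sub>E T"
    proof (rule PiE_I)
      fix B assume "B \<in> P"
      then obtain v where v: "v \<in> V" "B = cls v"
        unfolding P by blast
      then show "g B \<in> T"
        using PiE_mem[OF f v(1)] g[OF v(1)] by simp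
    qed (simp add: g_def)
    moreover have "inj_on g P"
    proof (rule inj_onI)
      fix B C
      assume BC: "B \<in> P" "C \<in> P" and eq: "g B = g C"
      obtain v w where v: "v \<in> V" "B = cls v" and w: "w \<in> V" "C = cls w"
        using BC unfolding P by blast
      have "f v = f w"
        using eq g[OF v(1)] g[OF w(1)] v(2) w(2) by simp
      then show "B = C"
        using cls_f[OF v(1)] cls_f[OF w(1)] v(2) w(2) by simp
    qed
    ultimately show "f \<in> (\<lambda>g. \<lambda>v\<in>V. g (cls v)) ` {g \<in> P \<rightarrow>\<^sub>E T. inj_on g P}"
      by blast
  qed
  then show ?thesis
    by (simp add: cls_def)
qed

text \<open>The product counts injections from \<open>P\<close> into \<open>T\<close>; with more
  blocks than colours it contains the factor 0.\<close>

lemma card_kernel_partition_eq: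
  assumes "partition_on V P" "finite V" "finite T"
  shows "card {f \<in> V \<rightarrow>\<^sub>E T. kernel_partition V f = P} = (\<Prod>i<card P. card T - i)"
proof -
  have "finite P"
    using assms by (auto intro: finite_elements)
  then show ?thesis
    using bij_betw_same_card[OF bij_betw_inj_on_kernel_partition[OF assms(1), of T]]
      card_inj_on_subset_funcset[of P T P] assms(3)
    by (simp add: lessThan_atLeast0)
qed

section \<open>Stable partitions and the count of proper colourings\<close>

lemma finite_stable_partitions: "finite (stable_partitions n E k)"
  by (rule finite_subset[OF _ finitely_many_partition_on[of "{1..n}"]])
    (auto simp: stable_partitions_def)

text \<open>Blocks are non-empty, so sending a vertex to its block maps \<open>{1..n}\<close> onto
  \<open>P\<close>.\<close>

lemma stable_partitions_le:
  assumes "P \<in> stable_partitions n E k"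
  shows "k \<le> n"
proof -
  have P: "partition_on {1..n} P" and k: "card P = k"
    using assms by (auto simp: stable_partitions_def)
  have "P \<subseteq> (\<lambda>v. THE B. B \<in> P \<and> v \<in> B) ` {1..n}"
  proof
    fix B assume B: "B \<in> P"
    then obtain v where v: "v \<in> B"
      using P by (metis ex_in_conv partition_onD3)
    have "(THE B. B \<in> P \<and> v \<in> B) = B"
      using P B v by (rule the_block_eq)
    moreover have "v \<in> {1..n}"
      unfolding partition_onD1[OF P] using B v by (rule UnionI)
    ultimately show "B \<in> (\<lambda>v. THE B. B \<in> P \<and> v \<in> B) ` {1..n}"
      by (rule image_eqI[OF sym])
  qed
  then have "card P \<le> card {1..n}"
    by (rule surj_card_le[rotated]) simp
  with k show ?thesis by simp
qed

text \<open>Two vertices share a class exactly when they share a colour. \<open>simple_graph\<close>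
  places the endpoints of every edge in \<open>{1..n}\<close>, where the classes live.\<close>

lemma proper_colourings_iff_kernel_partition:
  assumes "simple_graph n E" "f \<in> {1..n} \<rightarrow>\<^sub>E {1..x}"
  shows "f \<in> proper_colourings n E x \<longleftrightarrow>
    kernel_partition {1..n} f \<in> (\<Union>m\<le>n. stable_partitions n E m)"
proof -
  let ?P = "kernel_partition {1..n} f"
  have edge: "i \<in> {1..n} \<and> j \<in> {1..n}" if "{i, j} \<in> E" for i j
    using that assms(1) unfolding simple_graph_def by (fastforce simp: doubleton_eq_iff)
  have "(\<forall>B\<in>?P. \<not> (i \<in> B \<and> j \<in> B)) \<longleftrightarrow> f i \<noteq> f j" if "{i, j} \<in> E" for i j
    using edge[OF that] by (auto simp: kernel_partition_def)
  then have "f \<in> proper_colourings n E x \<longleftrightarrow> ?P \<in> stable_partitions n E (card ?P)"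
    using assms(2) partition_on_kernel_partition[of "{1..n}" f]
    by (simp add: proper_colourings_def stable_partitions_def cong: imp_cong)
  also have "\<dots> \<longleftrightarrow> ?P \<in> (\<Union>m\<le>n. stable_partitions n E m)"
    using stable_partitions_le[of ?P n E] by (auto simp: stable_partitions_def)
  finally show ?thesis .
qed

text \<open>Proper colourings are sorted by their kernel, and the size of each fibre depends only on
  the number of blocks.\<close>

lemma card_proper_colourings:
  assumes "simple_graph n E"
  shows "card (proper_colourings n E x) = (\<Sum>m\<le>n. graph_stirling n E m * (\<Prod>i<m. x - i))"
proof -
  let ?S = "stable_partitions n E"
  let ?F = "\<lambda>P. {f \<in> {1..n} \<rightarrow>\<^sub>E {1..x}. kernel_partition {1..n} f = P}"
  have fin: "finite (?F P)" for P
    by (rule finite_subset[OF _ finite_PiE[of "{1..n}" "\<lambda>_. {1..x}"]]) auto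
  have "proper_colourings n E x = (\<Union>P\<in>(\<Union>m\<le>n. ?S m). ?F P)"
    using proper_colourings_iff_kernel_partition[OF assms]
    by (auto simp: proper_colourings_def)
  also have "card \<dots> = (\<Sum>P\<in>(\<Union>m\<le>n. ?S m). card (?F P))"
    using fin finite_stable_partitions by (intro card_UN_disjoint) auto
  also have "\<dots> = (\<Sum>m\<le>n. \<Sum>P\<in>?S m. card (?F P))"
    using finite_stable_partitions
    by (intro sum.UNION_disjoint) (auto simp: stable_partitions_def)
  also have "\<dots> = (\<Sum>m\<le>n. \<Sum>P\<in>?S m. \<Prod>i<m. x - i)"
    by (intro sum.cong refl) (auto simp: stable_partitions_def card_kernel_partition_eq)
  finally show ?thesis
    by (simp add: graph_stirling_def)
qed

section \<open>From values at the naturals to an identity of polynomials\<close>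

lemma poly_eqI_of_nat:
  fixes p q :: "'a::{idom,ring_char_0} poly"
  assumes "\<And>x::nat. poly p (of_nat x) = poly q (of_nat x)"
  shows "p = q"
proof (rule ccontr)
  assume "p \<noteq> q"
  then have "finite {x. poly (p - q) x = 0}"
    by (intro poly_roots_finite) simp
  moreover have "range (of_nat :: nat \<Rightarrow> 'a) \<subseteq> {x. poly (p - q) x = 0}"
    using assms by auto
  ultimately have "finite (range (of_nat :: nat \<Rightarrow> 'a))"
    by (rule finite_subset[rotated])
  then show False
    by (simp add: finite_image_iff)
qed

text \<open>The definite description needs existence and uniqueness: the colouring count shows that
  the sum has the required values, and a polynomial is determined by its values at the
  naturals.\<close>

lemma chromatic_poly_eq:
  assumes "simple_graph n E"
  shows "chromatic_poly n E = (\<Sum>m\<le>n. smult (of_nat (graph_stirling n E m)) (ffact_poly m))"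
    (is "_ = ?q")
proof -
  have q: "poly ?q (of_nat x) = of_nat (card (proper_colourings n E x))" for x
    by (simp add: card_proper_colourings[OF assms] poly_sum poly_ffact_poly_of_nat)
  show ?thesis
    unfolding chromatic_poly_def
    by (rule the_equality) (auto intro!: poly_eqI_of_nat simp: q simp del: of_nat_prod)
qed

theorem theorem3p1:
  fixes n k :: nat and E :: "nat set set"
  assumes "simple_graph n E"
  shows "real (graph_stirling n E k) =
           1 / fact k * poly ((forward_diff ^^ k) (chromatic_poly n E)) 0"
proof -
  have "poly ((forward_diff ^^ k) (chromatic_poly n E)) 0
      = (\<Sum>m\<le>n. if m = k then real (graph_stirling n E m) * fact k else 0)"
    unfolding chromatic_poly_eq[OF assms] funpow_forward_diff_sum funpow_forward_diff_smult
    unfolding poly_sum poly_smult poly_funpow_forward_diff_ffact_poly_0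
    by (intro sum.cong refl) simp
  \<comment> \<open>For \<open>k > n\<close> the sum has no term with \<open>m = k\<close>, but then
    no stable partition has \<open>k\<close> blocks, so both sides are 0.\<close>
  also have "\<dots> = real (graph_stirling n E k) * fact k"
    using stable_partitions_le[of _ n E k]
    by (force simp: graph_stirling_def sum.delta)
  finally show ?thesis
    by simp
qed

end
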